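(* Let $\theta=(\theta_{j+\frac12})$ be the turning angles of a cooriented $n$-gon $\mathbf P$ with normal directions $\alpha_1,\dots,\alpha_n$. A pseudo-Steiner point exists for $\mathbf P$ (i.e. for the set of all cooriented $n$-gons with turning angles $\theta$) if and only if the $\mathcal P_\theta$-invariant subspace $\operatorname{span}\{C,S\}\subset\mathbb R^n$ has a $\mathcal P_\theta$-invariant complement: $$\mathbb R^n=\operatorname{span}\{C,S\}\oplus W,\qquad \mathcal P_\theta(W)\subset W,$$ where $C=(\cos\alpha_1,\dots,\cos\alpha_n)$ and $S=(\sin\alpha_1,\dots,\sin\alpha_n)$. If, in addition, the complexified restriction of $\mathcal P_\theta$ to $W$ does not have $\pm i$ as eigenvalues, then the pseudo-Steiner point is unique.
   Context: A cooriented line $(\alpha,p)$ is the line $x\cos\alpha+y\sin\alpha=p$ with coorienting normal $(\cos\alpha,\sin\alpha)$, oriented by the normal turned counterclockwise by $\pi/2$. A cooriented $n$-gon is a cyclic sequence of cooriented lines $l_j=(\alpha_j,p_j)$, $\alpha_j\in\mathbb R/2\pi\mathbb Z$ (indices mod $n$), with $l_j,l_{j+1}$ meeting at a single point $P_{j+\frac12}$; write it as $(\alpha,p)$. Turning angles: $\theta_{j+\frac12}\equiv\alpha_{j+1}-\alpha_j\pmod{2\pi}$, never $\equiv0\pmod\pi$. The $\mathcal P$-evolute is the polygon $(l_1^*,\dots,l_n^* )$, where $l_j^*$ passes through the midpoint of $P_{j-\frac12}P_{j+\frac12}$ and its direction is that of $l_j$ turned counterclockwise by $\pi/2$; in coordinates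 $\alpha^*_j=\alpha_j+\pi/2$ and $p^*=\mathcal P_\theta p$ with $$(\mathcal P_\theta p)_j=\tfrac12\bigl(-\csc\theta_{j-\frac12}\,p_{j-1}+(\cot\theta_{j-\frac12}-\cot\theta_{j+\frac12})p_j+\csc\theta_{j+\frac12}\,p_{j+1}\bigr).$$ A pseudo-Steiner point on the set of cooriented $n$-gons with turning angles $\theta$ (a set invariant under the $\mathcal P$-evolute) is a map $\operatorname{PS}$ from this set to $\mathbb R^2$ such that: (1) for fixed $\alpha$ it is linear in $p$: $\operatorname{PS}(\alpha,\lambda p+\mu q)=\lambda\operatorname{PS}(\alpha,p)+\mu\operatorname{PS}(\alpha,q)$; (2) $\operatorname{PS}(F(\alpha,p))=F(\operatorname{PS}(\alpha,p))$ for every proper (orientation-preserving) isometry $F$ of $\mathbb R^2$; (3) $\operatorname{PS}$ takes the same value on a polygon and on its $\mathcal P$-evolute. *)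

theory Defs
  imports
    "HOL-Analysis.Analysis"
    "HOL-Library.Real_Mod"
    "Berlekamp_Zassenhaus.Finite_Field"
begin

quotient_type angle = real / "\<lambda>x y. [x = y] (rmod (2 * pi))"
  by (intro equivpI reflpI sympI transpI) (auto intro: rcong_sym rcong_trans)

lift_definition Angle :: "real \<Rightarrow> angle" is "\<lambda>x. x" .

instantiation angle :: ab_group_add
begin

lift_definition zero_angle :: angle is 0 .
lift_definition plus_angle :: "angle \<Rightarrow> angle \<Rightarrow> angle" is "(+)" by (rule rcong_add)
lift_definition minus_angle :: "angle \<Rightarrow> angle \<Rightarrow> angle" is "(-)" by (rule rcong_diff)
lift_definition uminus_angle :: "angle \<Rightarrow> angle" is uminus by (rule rcong_uminus)

instance by standard (transfer; simp add: algebra_simps)+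

end

lemma cos_rcong: "[x = y] (rmod (2 * pi)) \<Longrightarrow> cos x = cos y"
  and sin_rcong: "[x = y] (rmod (2 * pi)) \<Longrightarrow> sin x = sin y"
  by (metis sin_cos_eq_iff rcong_altdef mult.commute mult.left_commute)+

lift_definition cos_angle :: "angle \<Rightarrow> real" is cos by (rule cos_rcong)
lift_definition sin_angle :: "angle \<Rightarrow> real" is sin by (rule sin_rcong)

definition cot_angle :: "angle \<Rightarrow> real" where
  "cot_angle \<theta> = cos_angle \<theta> / sin_angle \<theta>"

definition csc_angle :: "angle \<Rightarrow> real" where
  "csc_angle \<theta> = 1 / sin_angle \<theta>"

lemma angle_eqI: "cos_angle a = cos_angle b \<Longrightarrow> sin_angle a = sin_angle b \<Longrightarrow> a = b"
  by transfer (metis sin_cos_eq_iff rcong_altdef rcong_sym mult.commute mult.left_commute)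

lemma angle_add:
  "cos_angle (a + b) = cos_angle a * cos_angle b - sin_angle a * sin_angle b"
  "sin_angle (a + b) = sin_angle a * cos_angle b + cos_angle a * sin_angle b"
  by (transfer; simp add: cos_add sin_add)+

lemma angle_diff:
  "cos_angle (a - b) = cos_angle a * cos_angle b + sin_angle a * sin_angle b"
  "sin_angle (a - b) = sin_angle a * cos_angle b - cos_angle a * sin_angle b"
  by (transfer; simp add: cos_diff sin_diff)+

lemma angle_quarter:
  "cos_angle (a + Angle (pi / 2)) = - sin_angle a"
  "sin_angle (a + Angle (pi / 2)) = cos_angle a"
  by (transfer; simp add: cos_add sin_add)+

lemma angle_pythagoras: "cos_angle a * cos_angle a + sin_angle a * sin_angle a = 1"
  by transfer (simp flip: power2_eq_square)

type_synonym coline = "angle \<times> real"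

definition normal_vec :: "angle \<Rightarrow> real^2" where
  "normal_vec \<alpha> = vector [cos_angle \<alpha>, sin_angle \<alpha>]"

definition line_points :: "coline \<Rightarrow> (real^2) set" where
  "line_points l = {x. x \<bullet> normal_vec (fst l) = snd l}"

text \<open>Sides are indexed by \<open>'n mod_ring\<close>, the integers modulo \<open>n = CARD('n)\<close>, so index
  arithmetic is cyclic. A cyclic sequence \<open>u\<close> at half-integers is stored at the integers, with
  \<open>u $ j\<close> standing for the entry at \<open>j + 1/2\<close>. The sort \<open>nontriv\<close> only says \<open>n \<ge> 2\<close>; for \<open>n = 1\<close>
  there is no cooriented polygon.\<close>

type_synonym 'n copolygon = "(angle ^ 'n mod_ring) \<times> (real ^ 'n mod_ring)"

definition side :: "'n::nontriv copolygon \<Rightarrow> 'n mod_ring \<Rightarrow> coline" where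
  "side Q j = (fst Q $ j, snd Q $ j)"

definition cooriented_polygon :: "'n::nontriv copolygon \<Rightarrow> bool" where
  "cooriented_polygon Q \<longleftrightarrow>
     (\<forall>j. \<exists>!x. x \<in> line_points (side Q j) \<inter> line_points (side Q (j + 1)))"

definition vertex :: "'n::nontriv copolygon \<Rightarrow> 'n mod_ring \<Rightarrow> real^2" where
  "vertex Q j = (THE x. x \<in> line_points (side Q j) \<inter> line_points (side Q (j + 1)))"

definition turning :: "'n::nontriv copolygon \<Rightarrow> angle ^ 'n mod_ring" where
  "turning Q = (\<chi> j. fst Q $ (j + 1) - fst Q $ j)"

definition polygons :: "angle ^ 'n mod_ring \<Rightarrow> 'n::nontriv copolygon set" where
  "polygons \<theta> = {Q. cooriented_polygon Q \<and> turning Q = \<theta>}"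

text \<open>Turning the direction of a line counterclockwise by a right angle turns its normal likewise;
  the cooriented line with normal angle \<open>\<beta>\<close> through \<open>x\<close> is \<open>(\<beta>, normal_vec \<beta> \<bullet> x)\<close>.\<close>

definition evolute :: "'n::nontriv copolygon \<Rightarrow> 'n copolygon" where
  "evolute Q =
     (\<chi> j. fst Q $ j + Angle (pi / 2),
      \<chi> j. normal_vec (fst Q $ j + Angle (pi / 2)) \<bullet> midpoint (vertex Q (j - 1)) (vertex Q j))"

definition evolute_op ::
    "angle ^ 'n mod_ring \<Rightarrow> real ^ 'n mod_ring \<Rightarrow> real ^ 'n::nontriv mod_ring" where
  "evolute_op \<theta> p = (\<chi> j. 1 / 2 *
     (- csc_angle (\<theta> $ (j - 1)) * p $ (j - 1)
      + (cot_angle (\<theta> $ (j - 1)) - cot_angle (\<theta> $ j)) * p $ j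
      + csc_angle (\<theta> $ j) * p $ (j + 1)))"

definition cos_vec :: "angle ^ 'n mod_ring \<Rightarrow> real ^ 'n::nontriv mod_ring" where
  "cos_vec \<alpha> = (\<chi> j. cos_angle (\<alpha> $ j))"

definition sin_vec :: "angle ^ 'n mod_ring \<Rightarrow> real ^ 'n::nontriv mod_ring" where
  "sin_vec \<alpha> = (\<chi> j. sin_angle (\<alpha> $ j))"

text \<open>The determinant is that of the linear part of the isometry.\<close>

definition proper_isometry :: "(real^2 \<Rightarrow> real^2) \<Rightarrow> bool" where
  "proper_isometry F \<longleftrightarrow>
     (\<forall>x y. dist (F x) (F y) = dist x y) \<and> det (matrix (\<lambda>x. F x - F 0)) > 0"

definition image_line :: "(real^2 \<Rightarrow> real^2) \<Rightarrow> coline \<Rightarrow> coline" where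
  "image_line F l = (THE l'. line_points l' = F ` line_points l \<and>
     (\<forall>x. F (x + normal_vec (fst l)) = F x + normal_vec (fst l')))"

definition image_polygon :: "(real^2 \<Rightarrow> real^2) \<Rightarrow> 'n::nontriv copolygon \<Rightarrow> 'n copolygon" where
  "image_polygon F Q = (\<chi> j. fst (image_line F (side Q j)), \<chi> j. snd (image_line F (side Q j)))"

text \<open>A map defined on \<open>polygons \<theta>\<close> only is represented by an extensional function.\<close>

definition pseudo_Steiner ::
    "angle ^ 'n mod_ring \<Rightarrow> ('n::nontriv copolygon \<Rightarrow> real^2) \<Rightarrow> bool" where
  "pseudo_Steiner \<theta> PS \<longleftrightarrow>
     PS \<in> extensional (polygons \<theta>) \<and>
     (\<forall>\<alpha> p q c d. (\<alpha>, p) \<in> polygons \<theta> \<longrightarrow> (\<alpha>, q) \<in> polygons \<theta> \<longrightarrow>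
        PS (\<alpha>, c *\<^sub>R p + d *\<^sub>R q) = c *\<^sub>R PS (\<alpha>, p) + d *\<^sub>R PS (\<alpha>, q)) \<and>
     (\<forall>F. proper_isometry F \<longrightarrow> (\<forall>Q\<in>polygons \<theta>. PS (image_polygon F Q) = F (PS Q))) \<and>
     (\<forall>Q\<in>polygons \<theta>. PS (evolute Q) = PS Q)"

definition invariant_complement ::
    "('a::real_vector \<Rightarrow> 'a) \<Rightarrow> 'a set \<Rightarrow> 'a set \<Rightarrow> bool" where
  "invariant_complement f U W \<longleftrightarrow>
     subspace W \<and> U \<inter> W = {0} \<and> {u + w |u w. u \<in> U \<and> w \<in> W} = UNIV \<and> f ` W \<subseteq> W"

text \<open>A vector \<open>v\<close> of \<open>complex^'i\<close> is \<open>x + \<i> y\<close> with real \<open>x\<close>, \<open>y\<close>; it lies in the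
  complexification of \<open>W\<close> iff \<open>x\<close> and \<open>y\<close> lie in \<open>W\<close>, and \<open>f\<close> acts on it by
  \<open>f x + \<i> f y\<close>.\<close>

definition complexify_set :: "(real^'i) set \<Rightarrow> (complex^'i) set" where
  "complexify_set W = {\<chi> j. Complex (x $ j) (y $ j) |x y. x \<in> W \<and> y \<in> W}"

definition complexify_map :: "(real^'i \<Rightarrow> real^'i) \<Rightarrow> complex^'i \<Rightarrow> complex^'i" where
  "complexify_map f v =
     (\<chi> j. Complex (f (\<chi> k. Re (v $ k)) $ j) (f (\<chi> k. Im (v $ k)) $ j))"

definition complexified_eigenvalue ::
    "(real^'i \<Rightarrow> real^'i) \<Rightarrow> (real^'i) set \<Rightarrow> complex \<Rightarrow> bool" where
  "complexified_eigenvalue f W c \<longleftrightarrow>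
     (\<exists>v\<in>complexify_set W. v \<noteq> 0 \<and> complexify_map f v = c *s v)"

lemma inner_normal: "x \<bullet> normal_vec a = x $ 1 * cos_angle a + x $ 2 * sin_angle a"
  by (simp add: normal_vec_def inner_vec_def sum_2)

lemma meet_unique:
  "(\<exists>!x. x \<in> line_points (a, p) \<inter> line_points (b, q)) \<longleftrightarrow> sin_angle (b - a) \<noteq> 0"
proof
  assume u: "\<exists>!x. x \<in> line_points (a, p) \<inter> line_points (b, q)"
  show "sin_angle (b - a) \<noteq> 0"
  proof
    assume s: "sin_angle (b - a) = 0"
    from u obtain x where x: "x \<in> line_points (a, p) \<inter> line_points (b, q)" by blast
    define y :: "real^2" where "y = x + vector [- sin_angle a, cos_angle a]"
    have "y \<in> line_points (a, p) \<inter> line_points (b, q)"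
      using x s by (auto simp: y_def line_points_def inner_normal angle_diff algebra_simps)
    with u x have "y = x" by blast
    hence "sin_angle a = 0 \<and> cos_angle a = 0"
      by (simp add: y_def vec_eq_iff forall_2)
    thus False using angle_pythagoras[of a] by simp
  qed
next
  assume s: "sin_angle (b - a) \<noteq> 0"
  let ?d = "sin_angle (b - a)"
  define x0 :: "real^2" where
    "x0 = vector [(p * sin_angle b - q * sin_angle a) / ?d, (q * cos_angle a - p * cos_angle b) / ?d]"
  show "\<exists>!x. x \<in> line_points (a, p) \<inter> line_points (b, q)"
  proof (rule ex1I[of _ x0])
    have "(p * sin_angle b - q * sin_angle a) * cos_angle a
        + (q * cos_angle a - p * cos_angle b) * sin_angle a = p * ?d"
      "(p * sin_angle b - q * sin_angle a) * cos_angle b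
        + (q * cos_angle a - p * cos_angle b) * sin_angle b = q * ?d"
      by (simp_all add: angle_diff algebra_simps)
    with s show "x0 \<in> line_points (a, p) \<inter> line_points (b, q)"
      by (simp add: x0_def line_points_def inner_normal flip: add_divide_distrib)
  next
    fix x assume x: "x \<in> line_points (a, p) \<inter> line_points (b, q)"
    hence p: "p = x $ 1 * cos_angle a + x $ 2 * sin_angle a"
      and q: "q = x $ 1 * cos_angle b + x $ 2 * sin_angle b"
      by (simp_all add: line_points_def inner_normal)
    have "x $ 1 * ?d = p * sin_angle b - q * sin_angle a"
      "x $ 2 * ?d = q * cos_angle a - p * cos_angle b"
      unfolding p q by (simp_all add: angle_diff algebra_simps)
    with s show "x = x0"
      by (simp add: x0_def vec_eq_iff forall_2 eq_divide_eq)
  qed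
qed

lemma cooriented_polygon_iff: "cooriented_polygon Q \<longleftrightarrow> (\<forall>j. sin_angle (turning Q $ j) \<noteq> 0)"
  by (simp only: cooriented_polygon_def side_def meet_unique turning_def vec_lambda_beta)

lemma vertex_on_sides:
  assumes "cooriented_polygon Q"
  shows "vertex Q j \<bullet> normal_vec (fst Q $ j) = snd Q $ j"
    and "vertex Q j \<bullet> normal_vec (fst Q $ (j + 1)) = snd Q $ (j + 1)"
proof -
  have "vertex Q j \<in> line_points (side Q j) \<inter> line_points (side Q (j + 1))"
    unfolding vertex_def by (rule theI') (use assms in \<open>simp add: cooriented_polygon_def\<close>)
  thus "vertex Q j \<bullet> normal_vec (fst Q $ j) = snd Q $ j"
    and "vertex Q j \<bullet> normal_vec (fst Q $ (j + 1)) = snd Q $ (j + 1)"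
    by (simp_all add: line_points_def side_def)
qed

lemma meet_inner:
  assumes "sin_angle (b - a) \<noteq> 0" "x \<bullet> normal_vec a = p" "x \<bullet> normal_vec b = q"
  shows "x \<bullet> normal_vec (a + Angle (pi / 2)) = csc_angle (b - a) * q - cot_angle (b - a) * p"
    and "x \<bullet> normal_vec (b + Angle (pi / 2)) = cot_angle (b - a) * q - csc_angle (b - a) * p"
proof -
  let ?d = "sin_angle (b - a)" and ?c = "cos_angle (b - a)"
  have "x \<bullet> normal_vec (a + Angle (pi / 2)) * ?d = q - ?c * p"
  proof -
    have "x \<bullet> normal_vec (a + Angle (pi / 2)) * ?d
        = q * (cos_angle a * cos_angle a + sin_angle a * sin_angle a) - ?c * p"
      unfolding assms(2,3)[symmetric] inner_normal angle_quarter angle_diff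
      by (simp add: algebra_simps)
    thus ?thesis by (simp add: angle_pythagoras)
  qed
  moreover have "x \<bullet> normal_vec (b + Angle (pi / 2)) * ?d = ?c * q - p"
  proof -
    have "x \<bullet> normal_vec (b + Angle (pi / 2)) * ?d
        = ?c * q - p * (cos_angle b * cos_angle b + sin_angle b * sin_angle b)"
      unfolding assms(2,3)[symmetric] inner_normal angle_quarter angle_diff
      by (simp add: algebra_simps)
    thus ?thesis by (simp add: angle_pythagoras)
  qed
  ultimately show "x \<bullet> normal_vec (a + Angle (pi / 2)) = csc_angle (b - a) * q - cot_angle (b - a) * p"
    and "x \<bullet> normal_vec (b + Angle (pi / 2)) = cot_angle (b - a) * q - csc_angle (b - a) * p"
    using assms(1) by (simp_all add: csc_angle_def cot_angle_def field_simps)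
qed

lemma evolute_coords:
  assumes "Q \<in> polygons \<theta>"
  shows "evolute Q = (\<chi> j. fst Q $ j + Angle (pi / 2), evolute_op \<theta> (snd Q))"
proof -
  have Q: "cooriented_polygon Q" "turning Q = \<theta>" using assms by (auto simp: polygons_def)
  have t: "\<theta> $ j = fst Q $ (j + 1) - fst Q $ j" for j
    using Q(2) by (auto simp: turning_def)
  have s: "sin_angle (\<theta> $ j) \<noteq> 0" for j
    using Q by (auto simp: cooriented_polygon_iff)
  note v = vertex_on_sides[OF Q(1)]
  have a: "vertex Q j \<bullet> normal_vec (fst Q $ j + Angle (pi / 2))
      = csc_angle (\<theta> $ j) * snd Q $ (j + 1) - cot_angle (\<theta> $ j) * snd Q $ j" for j
    using meet_inner(1)[OF s[of j, unfolded t] v] by (simp add: t)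
  have b: "vertex Q (j - 1) \<bullet> normal_vec (fst Q $ j + Angle (pi / 2))
      = cot_angle (\<theta> $ (j - 1)) * snd Q $ j - csc_angle (\<theta> $ (j - 1)) * snd Q $ (j - 1)" for j
    using meet_inner(2)[OF s[of "j - 1", unfolded t] v] by (simp add: t)
  show ?thesis
    by (simp add: evolute_def evolute_op_def vec_eq_iff midpoint_def inner_commute[of "normal_vec _"]
        inner_add_left a b algebra_simps)
qed

lemma evolute_in_polygons: "Q \<in> polygons \<theta> \<Longrightarrow> evolute Q \<in> polygons \<theta>"
  by (auto simp: polygons_def cooriented_polygon_iff turning_def evolute_def)

lemma evolute_op_cos_sin:
  assumes "(\<alpha>, p) \<in> polygons \<theta>"
  shows "evolute_op \<theta> (cos_vec \<alpha>) = - sin_vec \<alpha>" and "evolute_op \<theta> (sin_vec \<alpha>) = cos_vec \<alpha>"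
proof -
  have m: "(\<alpha>, q) \<in> polygons \<theta>" for q
    using assms by (auto simp: polygons_def cooriented_polygon_iff turning_def)
  have v: "vertex (\<alpha>, \<chi> j. z \<bullet> normal_vec (\<alpha> $ j)) j = z" for z j
  proof -
    let ?Q = "(\<alpha>, \<chi> j. z \<bullet> normal_vec (\<alpha> $ j))"
    have "cooriented_polygon ?Q" using m by (auto simp: polygons_def)
    hence "\<exists>!x. x \<in> line_points (side ?Q j) \<inter> line_points (side ?Q (j + 1))"
      unfolding cooriented_polygon_def by blast
    thus ?thesis unfolding vertex_def
      by (rule the1_equality) (simp add: line_points_def side_def)
  qed
  have e: "evolute_op \<theta> (\<chi> j. z \<bullet> normal_vec (\<alpha> $ j)) = (\<chi> j. z \<bullet> normal_vec (\<alpha> $ j + Angle (pi / 2)))" for z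
    using evolute_coords[OF m[of "\<chi> j. z \<bullet> normal_vec (\<alpha> $ j)"]]
    by (simp add: evolute_def v inner_commute)
  show "evolute_op \<theta> (cos_vec \<alpha>) = - sin_vec \<alpha>" "evolute_op \<theta> (sin_vec \<alpha>) = cos_vec \<alpha>"
    using e[of "vector [1, 0]"] e[of "vector [0, 1]"]
    by (simp_all add: inner_normal angle_quarter cos_vec_def sin_vec_def vec_eq_iff)
qed

lemma span_cos_sin_invariant:
  assumes "(\<alpha>, p) \<in> polygons \<theta>"
  shows "evolute_op \<theta> ` span {cos_vec \<alpha>, sin_vec \<alpha>} \<subseteq> span {cos_vec \<alpha>, sin_vec \<alpha>}"
proof -
  have "linear (evolute_op \<theta>)"
    by (rule linearI) (simp_all add: evolute_op_def vec_eq_iff algebra_simps add_divide_distrib diff_divide_distrib)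
  hence "evolute_op \<theta> ` span {cos_vec \<alpha>, sin_vec \<alpha>}
      = span (evolute_op \<theta> ` {cos_vec \<alpha>, sin_vec \<alpha>})"
    by (rule linear_span_image[symmetric])
  also have "\<dots> \<subseteq> span {cos_vec \<alpha>, sin_vec \<alpha>}"
    by (rule span_minimal) (auto simp: evolute_op_cos_sin[OF assms] span_base span_neg)
  finally show ?thesis .
qed

lemma proper_isometry_form:
  assumes "proper_isometry F"
  obtains \<phi> where "\<And>x. F x = F 0 + vector
    [cos_angle \<phi> * x $ 1 - sin_angle \<phi> * x $ 2, sin_angle \<phi> * x $ 1 + cos_angle \<phi> * x $ 2]"
proof -
  define f where "f = (\<lambda>x. F x - F 0)"
  have "f 0 = 0" and "\<forall>x y. dist (f x) (f y) = dist x y"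
    using assms by (auto simp: f_def proper_isometry_def dist_norm)
  hence "orthogonal_transformation f" by (auto simp: orthogonal_transformation_isometry)
  hence f: "linear f" and om: "orthogonal_matrix (matrix f)"
    by (auto simp: orthogonal_transformation_matrix)
  have "det (matrix f) > 0" using assms by (simp add: proper_isometry_def f_def)
  hence det: "det (matrix f) = 1" using det_orthogonal_matrix[OF om] by auto
  define a b c d where "a = matrix f $ 1 $ 1" and "b = matrix f $ 1 $ 2"
    and "c = matrix f $ 2 $ 1" and "d = matrix f $ 2 $ 2"
  have abcd: "a * d - b * c = 1" using det by (simp add: det_2 a_def b_def c_def d_def)
  have "transpose (matrix f) ** matrix f = mat 1" using om by (simp add: orthogonal_matrix)
  hence o: "a * a + c * c = 1" "a * b + c * d = 0" "b * b + d * d = 1"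
    by (simp_all add: vec_eq_iff forall_2 matrix_matrix_mult_def transpose_def mat_def sum_2
        a_def b_def c_def d_def)
  have "d * (a * a + c * c) = a * (a * d - b * c) + c * (a * b + c * d)"
    "b * (a * a + c * c) = a * (a * b + c * d) - c * (a * d - b * c)"
    by (simp_all add: algebra_simps)
  hence bd: "b = - c" "d = a" using o abcd by simp_all
  obtain t where t: "a = cos t" "c = sin t"
    using sincos_total_2pi[of a c] o(1) by (auto simp: power2_eq_square)
  have cs: "cos_angle (Angle t) = a" "sin_angle (Angle t) = c"
    unfolding t by (transfer; simp)+
  have "F x = F 0 + vector [a * x $ 1 - c * x $ 2, c * x $ 1 + a * x $ 2]" for x
  proof -
    have "f x = matrix f *v x" using f by (simp add: matrix_works)
    hence "f x $ 1 = a * x $ 1 + b * x $ 2" "f x $ 2 = c * x $ 1 + d * x $ 2"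
      by (simp_all add: matrix_vector_mult_def sum_2 a_def b_def c_def d_def)
    thus ?thesis using bd by (simp add: f_def vec_eq_iff forall_2 algebra_simps)
  qed
  with that[of "Angle t"] show thesis unfolding cs by blast
qed

lemma image_line_coords:
  assumes F: "\<And>x. F x = t + vector
    [cos_angle \<phi> * x $ 1 - sin_angle \<phi> * x $ 2, sin_angle \<phi> * x $ 1 + cos_angle \<phi> * x $ 2]"
  shows "image_line F (a, p) = (a + \<phi>, p + t \<bullet> normal_vec (a + \<phi>))"
proof -
  have n: "F (x + normal_vec a) = F x + normal_vec (a + \<phi>)" for x
    by (simp add: F normal_vec_def vec_eq_iff forall_2 angle_add algebra_simps)
  have i: "F x \<bullet> normal_vec (a + \<phi>) = x \<bullet> normal_vec a + t \<bullet> normal_vec (a + \<phi>)" for x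
  proof -
    have "F x \<bullet> normal_vec (a + \<phi>) = (x \<bullet> normal_vec a)
        * (cos_angle \<phi> * cos_angle \<phi> + sin_angle \<phi> * sin_angle \<phi>) + t \<bullet> normal_vec (a + \<phi>)"
      unfolding F inner_normal angle_add by (simp add: algebra_simps)
    thus ?thesis by (simp add: angle_pythagoras)
  qed
  have surj: "\<exists>x. y = F x" for y
  proof
    let ?c = "cos_angle \<phi>" and ?s = "sin_angle \<phi>" and ?z = "y - t"
    have rot: "?c * (?c * u + ?s * v) - ?s * (?c * v - ?s * u) = u"
      "?s * (?c * u + ?s * v) + ?c * (?c * v - ?s * u) = v" for u v
    proof -
      have "?c * (?c * u + ?s * v) - ?s * (?c * v - ?s * u) = u * (?c * ?c + ?s * ?s)"
        "?s * (?c * u + ?s * v) + ?c * (?c * v - ?s * u) = v * (?c * ?c + ?s * ?s)"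
        by (simp_all add: algebra_simps)
      thus "?c * (?c * u + ?s * v) - ?s * (?c * v - ?s * u) = u"
        "?s * (?c * u + ?s * v) + ?c * (?c * v - ?s * u) = v"
        by (simp_all add: angle_pythagoras)
    qed
    show "y = F (vector [?c * ?z $ 1 + ?s * ?z $ 2, ?c * ?z $ 2 - ?s * ?z $ 1])"
      by (simp add: F vec_eq_iff forall_2 rot del: vector_minus_component) simp
  qed
  have img: "line_points (a + \<phi>, p + t \<bullet> normal_vec (a + \<phi>)) = F ` line_points (a, p)"
  proof (intro equalityI subsetI)
    fix y assume y: "y \<in> line_points (a + \<phi>, p + t \<bullet> normal_vec (a + \<phi>))"
    obtain x where x: "y = F x" using surj by blast
    with y i[of x] show "y \<in> F ` line_points (a, p)" by (auto simp: line_points_def)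
  qed (auto simp: line_points_def i)
  show ?thesis unfolding image_line_def
  proof (rule the_equality, goal_cases)
    case 1
    show ?case using img n by simp
  next
    case (2 l')
    have "normal_vec (fst l') = normal_vec (a + \<phi>)" using 2 n by (metis add_left_cancel fst_conv)
    hence l1: "fst l' = a + \<phi>"
      by (intro angle_eqI) (simp_all add: normal_vec_def vec_eq_iff forall_2)
    have "p *\<^sub>R normal_vec a \<in> line_points (a, p)"
      using angle_pythagoras[of a]
      by (simp add: line_points_def inner_normal) (simp add: normal_vec_def mult.assoc flip: distrib_left)
    hence "F (p *\<^sub>R normal_vec a) \<in> line_points l'"
      "F (p *\<^sub>R normal_vec a) \<in> line_points (a + \<phi>, p + t \<bullet> normal_vec (a + \<phi>))"
      using 2 img by auto
    hence "snd l' = p + t \<bullet> normal_vec (a + \<phi>)" by (simp add: line_points_def l1)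
    with l1 show ?case by (simp add: prod_eq_iff)
  qed
qed

lemma image_polygon_in_polygons:
  assumes "proper_isometry F" "Q \<in> polygons \<theta>"
  shows "image_polygon F Q \<in> polygons \<theta>"
proof -
  obtain \<phi> where "\<And>x. F x = F 0 + vector
    [cos_angle \<phi> * x $ 1 - sin_angle \<phi> * x $ 2, sin_angle \<phi> * x $ 1 + cos_angle \<phi> * x $ 2]"
    using proper_isometry_form[OF assms(1)] by blast
  note F = image_line_coords[OF this]
  show ?thesis using assms(2)
    by (auto simp: polygons_def cooriented_polygon_iff turning_def image_polygon_def side_def F)
qed

end

theory Submission
  imports Defs
begin

text \<open>Since \<open>\<alpha>\<close> is determined by \<open>\<theta>\<close> up to a common rotation, isometry equivariance makes a
  pseudo-Steiner point the same thing as a linear map \<open>L : \<real>\<^sup>n \<rightarrow> \<real>\<^sup>2\<close> (its values at the fixed \<open>\<alpha>\<close>)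
  with \<open>L (t\<^sub>1 C + t\<^sub>2 S) = t\<close> that intertwines the evolute operator with the rotation by \<open>-\<pi>/2\<close>.
  The kernel of such an \<open>L\<close> is an invariant complement of the span of \<open>C\<close> and \<open>S\<close>, and conversely
  the projection along an invariant complement is such an \<open>L\<close>. The difference \<open>D\<close> of two such maps
  satisfies \<open>D \<circ> (\<P>\<^sup>2 + 1) = 0\<close>. If \<open>D \<noteq> 0\<close>, then \<open>\<P>\<^sup>2 + 1\<close> is not onto on \<open>W\<close>, hence kills some
  \<open>w \<noteq> 0\<close> in \<open>W\<close>, and \<open>w - \<i> \<P> w\<close> is an eigenvector for \<open>\<i>\<close>.\<close>

subsection \<open>Rotations and rigid motions of the plane\<close>

text \<open>The body repeats the vector in \<open>proper_isometry_form\<close>, so that the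
  conclusion of that lemma folds back to \<open>rot\<close>.\<close>

definition rot :: "angle \<Rightarrow> real^2 \<Rightarrow> real^2" where
  "rot \<phi> x = vector
    [cos_angle \<phi> * x $ 1 - sin_angle \<phi> * x $ 2, sin_angle \<phi> * x $ 1 + cos_angle \<phi> * x $ 2]"

abbreviation quarter :: angle where "quarter \<equiv> Angle (pi / 2)"

lemma cos_sin_angle_0 [simp]: "cos_angle 0 = 1" "sin_angle 0 = 0"
  by (transfer; simp)+

lemma cos_sin_quarter [simp]: "cos_angle quarter = 0" "sin_angle quarter = 1"
  by (transfer; simp)+

lemma rot_0 [simp]: "rot 0 x = x"
  by (simp add: rot_def vec_eq_iff forall_2)

lemma linear_rot: "linear (rot \<phi>)"
  by (rule linearI) (simp_all add: rot_def vec_eq_iff forall_2 algebra_simps)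

lemma rot_rot: "rot \<phi> (rot \<psi> x) = rot (\<phi> + \<psi>) x"
  by (simp add: rot_def vec_eq_iff forall_2 angle_add algebra_simps)

lemma rot_minus_quarter: "rot (- quarter) x = vector [x $ 2, - x $ 1]"
proof -
  have "cos_angle (0 - quarter) = 0" "sin_angle (0 - quarter) = -1"
    by (simp_all only: angle_diff) simp_all
  thus ?thesis by (simp add: rot_def)
qed

lemma inner_rot_normal: "rot \<phi> x \<bullet> normal_vec (a + \<phi>) = x \<bullet> normal_vec a"
proof -
  have "rot \<phi> x \<bullet> normal_vec (a + \<phi>)
      = (x \<bullet> normal_vec a) * (cos_angle \<phi> * cos_angle \<phi> + sin_angle \<phi> * sin_angle \<phi>)"
    by (simp add: inner_normal rot_def angle_add algebra_simps)
  thus ?thesis by (simp add: angle_pythagoras)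
qed

lemma norm_rot: "norm (rot \<phi> x) = norm x"
proof -
  have "rot \<phi> x \<bullet> rot \<phi> x
      = (x \<bullet> x) * (cos_angle \<phi> * cos_angle \<phi> + sin_angle \<phi> * sin_angle \<phi>)"
    by (simp add: rot_def inner_vec_def sum_2 algebra_simps)
  thus ?thesis by (simp add: angle_pythagoras norm_eq_sqrt_inner)
qed

text \<open>Converse of \<open>proper_isometry_form\<close>: it supplies the isometries at which
  equivariance is instantiated.\<close>

lemma proper_isometry_rigid: "proper_isometry (\<lambda>x. t + rot \<phi> x)"
  unfolding proper_isometry_def
proof (intro conjI allI)
  fix x y
  show "dist (t + rot \<phi> x) (t + rot \<phi> y) = dist x y"
    by (simp add: dist_norm norm_rot flip: linear_diff[OF linear_rot])
next
  have "(\<lambda>x. t + rot \<phi> x - (t + rot \<phi> 0)) = rot \<phi>"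
    by (simp add: linear_0[OF linear_rot])
  moreover have "det (matrix (rot \<phi>)) = 1"
    using angle_pythagoras[of \<phi>] by (simp add: det_2 matrix_def rot_def axis_def)
  ultimately show "det (matrix (\<lambda>x. t + rot \<phi> x - (t + rot \<phi> 0))) > 0" by simp
qed

subsection \<open>The space of polygons with given turning angles\<close>

text \<open>Every residue is the image of a natural number, so induction from 0 reaches all
  indices.\<close>

lemma mod_ring_constant:
  fixes f :: "'n::nontriv mod_ring \<Rightarrow> 'b"
  assumes "\<And>j. f (j + 1) = f j"
  shows "f j = f 0"
proof -
  have *: "f (of_nat k) = f 0" for k
  proof (induction k)
    case (Suc k)
    have "of_nat (Suc k) = (of_nat k + 1 :: 'n mod_ring)" by simp
    thus ?case using Suc assms by metis
  qed simp
  have "j = of_int (to_int_mod_ring j)" by (simp add: of_int_of_int_mod_ring)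
  moreover have "to_int_mod_ring j \<ge> 0"
    using range_to_int_mod_ring[where 'a = 'n] by (metis atLeastLessThan_iff rangeI)
  ultimately have "j = of_nat (nat (to_int_mod_ring j))" by (metis nat_0_le of_int_of_nat_eq)
  thus ?thesis using * by metis
qed

lemma linear_evolute_op: "linear (evolute_op \<theta>)"
  by (rule linearI)
    (simp_all add: evolute_op_def vec_eq_iff algebra_simps add_divide_distrib diff_divide_distrib)

definition shift :: "angle ^ 'n mod_ring \<Rightarrow> angle \<Rightarrow> angle ^ 'n::nontriv mod_ring" where
  "shift \<alpha> \<phi> = (\<chi> j. \<alpha> $ j + \<phi>)"

text \<open>The support numbers of the degenerate polygon all of whose sides pass through \<open>t\<close>.\<close>

definition support :: "angle ^ 'n mod_ring \<Rightarrow> real^2 \<Rightarrow> real ^ 'n::nontriv mod_ring" where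
  "support \<alpha> t = (\<chi> j. t \<bullet> normal_vec (\<alpha> $ j))"

lemma shift_nth [simp]: "shift \<alpha> \<phi> $ j = \<alpha> $ j + \<phi>"
  by (simp add: shift_def)

lemma shift_0 [simp]: "shift \<alpha> 0 = \<alpha>"
  by (simp add: shift_def vec_eq_iff)

lemma shift_shift: "shift (shift \<alpha> \<phi>) \<psi> = shift \<alpha> (\<phi> + \<psi>)"
  by (simp add: vec_eq_iff add.assoc)

lemma linear_support: "linear (support \<alpha>)"
  by (rule linearI) (simp_all add: support_def vec_eq_iff inner_add_left)

lemma support_shift_rot: "support (shift \<alpha> \<phi>) (rot \<phi> t) = support \<alpha> t"
  by (simp add: support_def inner_rot_normal)

lemma support_eq: "support \<alpha> t = t $ 1 *\<^sub>R cos_vec \<alpha> + t $ 2 *\<^sub>R sin_vec \<alpha>"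
  by (simp add: support_def cos_vec_def sin_vec_def vec_eq_iff inner_normal)

text \<open>The coordinates of a point \<open>t\<close> are the coefficients of C and S in its
  support numbers, so points of the plane parametrize the subspace.\<close>

lemma span_cos_sin: "span {cos_vec \<alpha>, sin_vec \<alpha>} = range (support \<alpha>)"
proof
  have "support \<alpha> (vector [1, 0]) = cos_vec \<alpha>" "support \<alpha> (vector [0, 1]) = sin_vec \<alpha>"
    by (simp_all add: support_eq)
  hence "cos_vec \<alpha> \<in> range (support \<alpha>)" "sin_vec \<alpha> \<in> range (support \<alpha>)"
    by (metis rangeI)+
  thus "span {cos_vec \<alpha>, sin_vec \<alpha>} \<subseteq> range (support \<alpha>)"
    by (intro span_minimal linear_subspace_image[OF linear_support])
      (simp_all only: insert_subset empty_subsetI subspace_UNIV simp_thms)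
  show "range (support \<alpha>) \<subseteq> span {cos_vec \<alpha>, sin_vec \<alpha>}"
  proof clarify
    show "support \<alpha> t \<in> span {cos_vec \<alpha>, sin_vec \<alpha>}" for t
      unfolding support_eq by (intro span_add span_scale span_base) auto
  qed
qed

text \<open>A rotation about the origin only shifts the normal angles; a translation only adds the
  support numbers of its vector.\<close>

lemma image_polygon_rigid:
  "image_polygon (\<lambda>x. t + rot \<phi> x) (\<beta>, q) = (shift \<beta> \<phi>, q + support (shift \<beta> \<phi>) t)"
proof -
  have "image_line (\<lambda>x. t + rot \<phi> x) (a, r) = (a + \<phi>, r + t \<bullet> normal_vec (a + \<phi>))" for a r
    by (rule image_line_coords) (simp add: rot_def)
  thus ?thesis
    by (simp add: image_polygon_def side_def shift_def support_def vec_eq_iff)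
qed

text \<open>Normal angles with equal successive differences differ by one constant. Conversely, a
  common shift preserves \<open>turning\<close>, which alone decides membership, so \<open>q\<close>
  is arbitrary.\<close>

lemma polygons_iff_shift:
  assumes "(\<alpha>, p) \<in> polygons \<theta>"
  shows "(\<beta>, q) \<in> polygons \<theta> \<longleftrightarrow> (\<exists>\<phi>. \<beta> = shift \<alpha> \<phi>)"
proof
  assume "(\<beta>, q) \<in> polygons \<theta>"
  hence "turning (\<beta>, q) = turning (\<alpha>, p)" using assms by (simp add: polygons_def)
  hence d: "\<beta> $ (j + 1) - \<beta> $ j = \<alpha> $ (j + 1) - \<alpha> $ j" for j
    by (simp add: turning_def vec_eq_iff)
  have "\<beta> $ (j + 1) - \<alpha> $ (j + 1) = \<beta> $ j - \<alpha> $ j" for j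
    using d[of j] by (simp add: algebra_simps)
  hence *: "\<beta> $ j - \<alpha> $ j = \<beta> $ 0 - \<alpha> $ 0" for j
    by (rule mod_ring_constant)
  have "\<beta> $ j = \<alpha> $ j + (\<beta> $ 0 - \<alpha> $ 0)" for j
    using *[of j] by (simp add: algebra_simps)
  hence "\<beta> = shift \<alpha> (\<beta> $ 0 - \<alpha> $ 0)" unfolding vec_eq_iff shift_nth by (rule allI)
  thus "\<exists>\<phi>. \<beta> = shift \<alpha> \<phi>" ..
next
  assume "\<exists>\<phi>. \<beta> = shift \<alpha> \<phi>"
  thus "(\<beta>, q) \<in> polygons \<theta>"
    using assms by (auto simp: polygons_def cooriented_polygon_iff turning_def)
qed

lemma evolute_shift:
  "(\<beta>, q) \<in> polygons \<theta> \<Longrightarrow> evolute (\<beta>, q) = (shift \<beta> quarter, evolute_op \<theta> q)"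
  by (simp add: evolute_coords shift_def)

subsection \<open>Pseudo-Steiner points as linear maps\<close>

text \<open>The minus sign arises because the evolute has normals shifted by \<open>quarter\<close>:
  invariance and equivariance give
  \<open>L q = rot quarter (L (evolute_op \<theta> q))\<close>.\<close>

definition Steiner_map ::
    "angle ^ 'n mod_ring \<Rightarrow> angle ^ 'n mod_ring \<Rightarrow> (real ^ 'n::nontriv mod_ring \<Rightarrow> real^2) \<Rightarrow> bool"
  where "Steiner_map \<alpha> \<theta> L \<longleftrightarrow> linear L \<and> (\<forall>t. L (support \<alpha> t) = t) \<and>
    (\<forall>q. L (evolute_op \<theta> q) = rot (- quarter) (L q))"

lemma pseudo_Steiner_shift:
  assumes "(\<alpha>, p) \<in> polygons \<theta>" "pseudo_Steiner \<theta> PS"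
  shows "PS (shift \<alpha> \<phi>, q + support (shift \<alpha> \<phi>) t) = t + rot \<phi> (PS (\<alpha>, q))"
proof -
  have "(\<alpha>, q) \<in> polygons \<theta>" using polygons_iff_shift[OF assms(1), of \<alpha> q] shift_0 by metis
  thus ?thesis
    using assms(2) proper_isometry_rigid[of t \<phi>] unfolding pseudo_Steiner_def
    by (metis image_polygon_rigid)
qed

lemma Steiner_map_of_pseudo_Steiner:
  assumes "(\<alpha>, p) \<in> polygons \<theta>" "pseudo_Steiner \<theta> PS"
  shows "Steiner_map \<alpha> \<theta> (\<lambda>q. PS (\<alpha>, q))"
proof -
  have mem: "(\<alpha>, q) \<in> polygons \<theta>" for q
    using polygons_iff_shift[OF assms(1), of \<alpha> q] shift_0 by metis
  have comb: "PS (\<alpha>, c *\<^sub>R p + d *\<^sub>R q) = c *\<^sub>R PS (\<alpha>, p) + d *\<^sub>R PS (\<alpha>, q)" for c d p q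
    using assms(2) mem unfolding pseudo_Steiner_def by blast
  have lin: "linear (\<lambda>q. PS (\<alpha>, q))"
  proof (rule linearI)
    show "PS (\<alpha>, x + y) = PS (\<alpha>, x) + PS (\<alpha>, y)" for x y
      using comb[of 1 x 1 y] by simp
    show "PS (\<alpha>, c *\<^sub>R x) = c *\<^sub>R PS (\<alpha>, x)" for c x
      using comb[of c x 0 x] by simp
  qed
  note shift = pseudo_Steiner_shift[OF assms]
  \<comment> \<open>The polygon is the translate by \<open>t\<close> of the one with zero support
    numbers, whose value is 0 by linearity.\<close>
  have "PS (\<alpha>, support \<alpha> t) = t" for t
    using shift[of 0 0 t] linear_0[OF lin] by simp
  moreover have "PS (\<alpha>, evolute_op \<theta> q) = rot (- quarter) (PS (\<alpha>, q))" for q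
  proof -
    have "PS (\<alpha>, q) = PS (evolute (\<alpha>, q))"
      using assms(2) mem unfolding pseudo_Steiner_def by simp
    also have "\<dots> = rot quarter (PS (\<alpha>, evolute_op \<theta> q))"
      using shift[of quarter "evolute_op \<theta> q" 0]
      by (simp add: evolute_shift[OF mem] linear_0[OF linear_support])
    finally show ?thesis by (simp add: rot_rot)
  qed
  ultimately show ?thesis using lin by (simp add: Steiner_map_def)
qed

text \<open>Outside \<open>polygons \<theta>\<close> extensionality fixes the value; inside, every
  polygon is a rotated copy of one with normal angles \<alpha>.\<close>

lemma pseudo_Steiner_eqI:
  assumes "(\<alpha>, p) \<in> polygons \<theta>" "pseudo_Steiner \<theta> PS" "pseudo_Steiner \<theta> PS'"
    and "\<And>q. PS (\<alpha>, q) = PS' (\<alpha>, q)"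
  shows "PS = PS'"
proof (rule extensionalityI[of _ "polygons \<theta>"])
  show "PS \<in> extensional (polygons \<theta>)" "PS' \<in> extensional (polygons \<theta>)"
    using assms(2,3) by (simp_all add: pseudo_Steiner_def)
  fix Q assume Q: "Q \<in> polygons \<theta>"
  obtain \<beta> q where "Q = (\<beta>, q)" by force
  moreover from this Q obtain \<phi> where "\<beta> = shift \<alpha> \<phi>"
    using polygons_iff_shift[OF assms(1)] by blast
  ultimately show "PS Q = PS' Q"
    using pseudo_Steiner_shift[OF assms(1,2), of \<phi> q 0] pseudo_Steiner_shift[OF assms(1,3), of \<phi> q 0]
      assms(4) by (simp add: linear_0[OF linear_support])
qed

text \<open>The rotation away from \<alpha> is read off at index 0; on
  \<open>polygons \<theta>\<close> every index gives the same angle.\<close>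

lemma pseudo_Steiner_of_Steiner_map:
  assumes "(\<alpha>, p) \<in> polygons \<theta>" "Steiner_map \<alpha> \<theta> L"
  shows "pseudo_Steiner \<theta> (restrict (\<lambda>Q. rot (fst Q $ 0 - \<alpha> $ 0) (L (snd Q))) (polygons \<theta>))"
    (is "pseudo_Steiner \<theta> ?PS")
proof -
  note mem = polygons_iff_shift[OF assms(1)]
  have lin: "linear L" and sup: "L (support \<alpha> t) = t"
    and ev: "L (evolute_op \<theta> q) = rot (- quarter) (L q)" for t q
    using assms(2) by (simp_all add: Steiner_map_def)
  have PS: "?PS (shift \<alpha> \<phi>, q) = rot \<phi> (L q)" for \<phi> q
    using mem by auto
  \<comment> \<open>Rotating back by \<phi> gives the lines with normals \<alpha> through
    \<open>rot (- \<phi>) t\<close>, where \<open>sup\<close> applies.\<close>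
  have sup_shift: "rot \<phi> (L (support (shift \<alpha> \<phi>) t)) = t" for \<phi> t
    using support_shift_rot[of \<alpha> \<phi> "rot (- \<phi>) t"] sup[of "rot (- \<phi>) t"] by (simp add: rot_rot)
  show ?thesis unfolding pseudo_Steiner_def
  proof (intro conjI allI impI ballI)
    show "?PS \<in> extensional (polygons \<theta>)" by simp
  next
    fix \<beta> q r c d assume "(\<beta>, q) \<in> polygons \<theta>"
    then obtain \<phi> where "\<beta> = shift \<alpha> \<phi>" using mem by blast
    thus "?PS (\<beta>, c *\<^sub>R q + d *\<^sub>R r) = c *\<^sub>R ?PS (\<beta>, q) + d *\<^sub>R ?PS (\<beta>, r)"
      by (simp only: PS linear_add[OF lin] linear_scale[OF lin] linear_add[OF linear_rot]
          linear_scale[OF linear_rot])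
  next
    fix F and Q :: "'a copolygon" assume F: "proper_isometry F" and Q: "Q \<in> polygons \<theta>"
    obtain \<beta> q where "Q = (\<beta>, q)" by force
    with Q mem obtain \<psi> where Q': "Q = (shift \<alpha> \<psi>, q)" by blast
    obtain \<phi> where "\<And>x. F x = F 0 + rot \<phi> x"
      using proper_isometry_form[OF F] unfolding rot_def[symmetric] by blast
    then obtain t where Ft: "F = (\<lambda>x. t + rot \<phi> x)" by blast
    show "?PS (image_polygon F Q) = F (?PS Q)"
      unfolding Q' Ft image_polygon_rigid shift_shift PS
      by (simp add: linear_add[OF lin] linear_add[OF linear_rot] sup_shift rot_rot add.commute)
  next
    fix Q assume Q: "Q \<in> polygons \<theta>"
    obtain \<beta> q where "Q = (\<beta>, q)" by force
    with Q mem obtain \<psi> where Q': "Q = (shift \<alpha> \<psi>, q)" by blast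
    \<comment> \<open>The shift of the normals by \<open>quarter\<close> cancels the rotation by
      \<open>- quarter\<close> in \<open>ev\<close>.\<close>
    show "?PS (evolute Q) = ?PS Q"
      using Q unfolding Q'
      by (simp only: evolute_shift shift_shift PS ev rot_rot) simp
  qed
qed

subsection \<open>Invariant complements\<close>

text \<open>Since \<open>L\<close> is a left inverse of \<open>support \<alpha>\<close>, the
  component of \<open>q\<close> in the span is \<open>support \<alpha> (L q)\<close>, and the rest
  lies in the kernel.\<close>

lemma invariant_complement_kernel:
  assumes "Steiner_map \<alpha> \<theta> L"
  shows "invariant_complement (evolute_op \<theta>) (span {cos_vec \<alpha>, sin_vec \<alpha>}) {q. L q = 0}"
proof -
  have lin: "linear L" and sup: "L (support \<alpha> t) = t"
    and ev: "L (evolute_op \<theta> q) = rot (- quarter) (L q)" for t q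
    using assms by (simp_all add: Steiner_map_def)
  have "\<exists>u w. q = u + w \<and> u \<in> range (support \<alpha>) \<and> L w = 0" for q
    by (rule exI[of _ "support \<alpha> (L q)"], rule exI[of _ "q - support \<alpha> (L q)"])
      (simp add: linear_diff[OF lin] sup)
  moreover have "range (support \<alpha>) \<inter> {q. L q = 0} = {0}"
    using sup linear_0[OF linear_support, of \<alpha>] linear_0[OF lin] by (auto simp: image_iff)
  ultimately show ?thesis
    unfolding invariant_complement_def span_cos_sin
    using linear_subspace_kernel[OF lin] by (auto simp: ev linear_0[OF linear_rot])
qed

text \<open>If the support numbers of \<open>t\<close> vanish, then \<open>t\<close> and the origin
  both lie on the parallels to sides 0 and 1 through the origin, which meet only once.\<close>

lemma inj_support:
  assumes "(\<alpha>, p) \<in> polygons \<theta>"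
  shows "inj (support \<alpha>)"
proof (rule linear_injective_0[OF linear_support, THEN iffD2], intro allI impI)
  fix t assume "support \<alpha> t = 0"
  hence z: "t \<bullet> normal_vec (\<alpha> $ j) = 0" for j by (simp add: support_def vec_eq_iff)
  have "\<forall>j. sin_angle (\<alpha> $ (j + 1) - \<alpha> $ j) \<noteq> 0"
    using assms by (auto simp: polygons_def cooriented_polygon_iff turning_def)
  hence "sin_angle (\<alpha> $ (0 + 1) - \<alpha> $ 0) \<noteq> 0" by (rule spec)
  hence "\<exists>!x. x \<in> line_points (\<alpha> $ 0, 0) \<inter> line_points (\<alpha> $ (0 + 1), 0)"
    by (simp only: meet_unique not_False_eq_True)
  moreover have "t \<in> line_points (\<alpha> $ 0, 0) \<inter> line_points (\<alpha> $ (0 + 1), 0)"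
    "0 \<in> line_points (\<alpha> $ 0, 0) \<inter> line_points (\<alpha> $ (0 + 1), 0)"
    using z by (auto simp: line_points_def)
  ultimately show "t = 0" by blast
qed

lemma evolute_op_support:
  assumes "(\<alpha>, p) \<in> polygons \<theta>"
  shows "evolute_op \<theta> (support \<alpha> t) = support \<alpha> (rot (- quarter) t)"
  by (simp add: support_eq rot_minus_quarter linear_add[OF linear_evolute_op]
      linear_scale[OF linear_evolute_op] evolute_op_cos_sin[OF assms])

lemma Steiner_map_of_invariant_complement:
  assumes "(\<alpha>, p) \<in> polygons \<theta>"
    and "invariant_complement (evolute_op \<theta>) (span {cos_vec \<alpha>, sin_vec \<alpha>}) W"
  obtains L where "Steiner_map \<alpha> \<theta> L"
proof -
  have W: "subspace W" "range (support \<alpha>) \<inter> W = {0}"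
    "{u + w |u w. u \<in> range (support \<alpha>) \<and> w \<in> W} = UNIV" "evolute_op \<theta> ` W \<subseteq> W"
    using assms(2) by (simp_all add: invariant_complement_def span_cos_sin)
  have "\<exists>t. q - support \<alpha> t \<in> W" for q
  proof -
    have "q \<in> {u + w |u w. u \<in> range (support \<alpha>) \<and> w \<in> W}" using W(3) by simp
    then obtain t w where "q = support \<alpha> t + w" "w \<in> W" by blast
    thus ?thesis by (metis add_diff_cancel_left')
  qed
  then obtain L where L: "\<And>q. q - support \<alpha> (L q) \<in> W" by metis
  \<comment> \<open>The sum is direct and \<open>support \<alpha>\<close> is injective, so
    \<open>L q\<close> is the only such point. Each law for \<open>L\<close> below thereby becomes a
    membership in \<open>W\<close>.\<close>
  have uniq: "L q = t" if "q - support \<alpha> t \<in> W" for q t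
  proof -
    have "(q - support \<alpha> t) - (q - support \<alpha> (L q)) \<in> W"
      using that L W(1) by (blast intro: subspace_diff)
    hence "support \<alpha> (L q - t) \<in> W" by (simp add: linear_diff[OF linear_support])
    hence "support \<alpha> (L q - t) = support \<alpha> 0"
      using W(2) by (auto simp: linear_0[OF linear_support])
    thus ?thesis using injD[OF inj_support[OF assms(1)]] by fastforce
  qed
  have "linear L"
  proof (rule linearI; rule uniq)
    fix x y
    have "(x - support \<alpha> (L x)) + (y - support \<alpha> (L y)) \<in> W"
      using L W(1) by (blast intro: subspace_add)
    thus "x + y - support \<alpha> (L x + L y) \<in> W"
      by (simp add: linear_add[OF linear_support] algebra_simps)
  next
    fix c x
    have "c *\<^sub>R (x - support \<alpha> (L x)) \<in> W"
      using L W(1) by (blast intro: subspace_scale)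
    thus "c *\<^sub>R x - support \<alpha> (c *\<^sub>R L x) \<in> W"
      by (simp add: linear_scale[OF linear_support] algebra_simps)
  qed
  moreover have "L (support \<alpha> t) = t" for t
    by (rule uniq) (simp add: subspace_0[OF W(1)])
  moreover have "L (evolute_op \<theta> q) = rot (- quarter) (L q)" for q
  proof (rule uniq)
    have "evolute_op \<theta> (q - support \<alpha> (L q)) \<in> W" using L W(4) by blast
    thus "evolute_op \<theta> q - support \<alpha> (rot (- quarter) (L q)) \<in> W"
      by (simp add: linear_diff[OF linear_evolute_op] evolute_op_support[OF assms(1)])
  qed
  ultimately have "Steiner_map \<alpha> \<theta> L" by (simp add: Steiner_map_def)
  thus thesis by (rule that)
qed

section \<open>The eigenvalue i and uniqueness\<close>

lemma eigenvalue_i_of_square: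
  assumes "linear f" "subspace W" "f ` W \<subseteq> W" "w \<in> W" "w \<noteq> 0" "f (f w) = - w"
  shows "complexified_eigenvalue f W \<i>"
  unfolding complexified_eigenvalue_def
proof (intro bexI conjI)
  \<comment> \<open>This is w - i f w. Its image f w - i f (f w) = f w + i w is i times it, and its
    real part w is nonzero.\<close>
  let ?v = "\<chi> j. Complex (w $ j) ((- f w) $ j)"
  show "?v \<in> complexify_set W"
    using assms(2-4) unfolding complexify_set_def by (blast intro: subspace_neg)
  show "?v \<noteq> 0"
    using assms(5) by (auto simp: vec_eq_iff complex_eq_iff)
  have eta: "(\<chi> k. - f w $ k) = - f w" "(\<chi> k. w $ k) = w" by (simp_all add: vec_eq_iff)
  show "complexify_map f ?v = \<i> *s ?v"
    unfolding complexify_map_def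
    by (simp add: eta linear_neg[OF assms(1)] assms(6)) (simp add: vec_eq_iff complex_eq_iff)
qed

lemma Steiner_map_unique:
  assumes "invariant_complement (evolute_op \<theta>) (span {cos_vec \<alpha>, sin_vec \<alpha>}) W"
    and "\<not> complexified_eigenvalue (evolute_op \<theta>) W \<i>"
    and "Steiner_map \<alpha> \<theta> L" "Steiner_map \<alpha> \<theta> L'"
  shows "L q = L' q"
proof -
  let ?P = "evolute_op \<theta>"
  define g where "g = (\<lambda>w. ?P (?P w) + w)"
  have W: "subspace W" "{u + w |u w. u \<in> range (support \<alpha>) \<and> w \<in> W} = UNIV" "?P ` W \<subseteq> W"
    using assms(1) by (simp_all add: invariant_complement_def span_cos_sin)
  have lin: "linear L" "linear L'" and sup: "L (support \<alpha> t) = L' (support \<alpha> t)"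
    and ev: "L (?P q) = rot (- quarter) (L q)" "L' (?P q) = rot (- quarter) (L' q)" for t q
    using assms(3,4) by (simp_all add: Steiner_map_def)
  have linP: "linear ?P" by (rule linear_evolute_op)
  have ling: "linear g" unfolding g_def
    by (intro linear_compose_add linear_ident) (use linear_compose[OF linP linP] in \<open>simp add: o_def\<close>)
  have gW: "g ` W \<subseteq> W"
    using W(1,3) by (auto simp: g_def intro!: subspace_add)
  have "inj_on g W"
  proof (rule linear_inj_on_iff_eq_0[OF ling W(1), THEN iffD2], intro ballI impI, rule ccontr)
    fix w assume w: "w \<in> W" "g w = 0" "w \<noteq> 0"
    hence "?P (?P w) = - w" by (simp add: g_def eq_neg_iff_add_eq_0)
    thus False using eigenvalue_i_of_square[OF linP W(1,3) w(1,3)] assms(2) by blast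
  qed
  \<comment> \<open>An injective endomorphism of the finite-dimensional \<open>W\<close> is
    onto.\<close>
  hence "dim (g ` W) = dim W"
    using W(1) by (intro dim_image_eq ling) (simp add: span_eq_iff[THEN iffD2])
  hence onto: "g ` W = W"
    using gW W(1) linear_subspace_image[OF ling W(1)] by (intro subspace_dim_equal) auto
  \<comment> \<open>Two rotations by \<open>- quarter\<close> amount to -1, so the two terms of
    \<open>g\<close> cancel under \<open>L\<close>.\<close>
  have "L (g w) = 0" if "linear L" "\<And>q. L (?P q) = rot (- quarter) (L q)" for L w
    by (simp add: g_def linear_add[OF that(1)] that(2) rot_minus_quarter vec_eq_iff forall_2)
  from this[OF lin(1) ev(1)] this[OF lin(2) ev(2)] have eq: "L (g w) = L' (g w)" for w by simp
  have "q \<in> {u + w |u w. u \<in> range (support \<alpha>) \<and> w \<in> W}" using W(2) by simp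
  then obtain t w where q: "q = support \<alpha> t + w" and "w \<in> g ` W"
    using onto by blast
  hence "L w = L' w" using eq by blast
  thus ?thesis unfolding q by (simp add: linear_add[OF lin(1)] linear_add[OF lin(2)] sup)
qed

theorem theorem6:
  fixes \<alpha> :: "angle ^ 'n::nontriv mod_ring" and p :: "real ^ 'n mod_ring"
    and \<theta> :: "angle ^ 'n mod_ring"
  assumes "cooriented_polygon (\<alpha>, p)" and "\<theta> = turning (\<alpha>, p)"
  shows "((\<exists>PS. pseudo_Steiner \<theta> PS) \<longleftrightarrow>
          (\<exists>W. invariant_complement (evolute_op \<theta>) (span {cos_vec \<alpha>, sin_vec \<alpha>}) W)) \<and>
         (\<forall>W. invariant_complement (evolute_op \<theta>) (span {cos_vec \<alpha>, sin_vec \<alpha>}) W \<longrightarrow>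
            \<not> complexified_eigenvalue (evolute_op \<theta>) W \<i> \<longrightarrow>
            \<not> complexified_eigenvalue (evolute_op \<theta>) W (- \<i>) \<longrightarrow>
            (\<exists>!PS. pseudo_Steiner \<theta> PS))"
proof -
  have mem: "(\<alpha>, p) \<in> polygons \<theta>" using assms by (simp add: polygons_def)
  \<comment> \<open>Stated for any complement, as both the equivalence and the uniqueness clause
    draw on it.\<close>
  have ex: "\<exists>PS. pseudo_Steiner \<theta> PS"
    if W: "invariant_complement (evolute_op \<theta>) (span {cos_vec \<alpha>, sin_vec \<alpha>}) W" for W
  proof -
    obtain L where L: "Steiner_map \<alpha> \<theta> L"
      by (rule Steiner_map_of_invariant_complement[OF mem W])
    show ?thesis by (rule exI) (rule pseudo_Steiner_of_Steiner_map[OF mem L])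
  qed
  show ?thesis
  proof (intro conjI iffI allI impI)
    assume "\<exists>PS. pseudo_Steiner \<theta> PS"
    then obtain PS where PS: "pseudo_Steiner \<theta> PS" ..
    show "\<exists>W. invariant_complement (evolute_op \<theta>) (span {cos_vec \<alpha>, sin_vec \<alpha>}) W"
      by (rule exI) (rule invariant_complement_kernel[OF Steiner_map_of_pseudo_Steiner[OF mem PS]])
  next
    assume "\<exists>W. invariant_complement (evolute_op \<theta>) (span {cos_vec \<alpha>, sin_vec \<alpha>}) W"
    thus "\<exists>PS. pseudo_Steiner \<theta> PS" by (elim exE) (rule ex)
  next
    fix W
    assume W: "invariant_complement (evolute_op \<theta>) (span {cos_vec \<alpha>, sin_vec \<alpha>}) W"
      "\<not> complexified_eigenvalue (evolute_op \<theta>) W \<i>"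
    show "\<exists>!PS. pseudo_Steiner \<theta> PS"
    proof (rule ex_ex1I)
      show "\<exists>PS. pseudo_Steiner \<theta> PS" by (rule ex[OF W(1)])
      fix PS PS' assume PS: "pseudo_Steiner \<theta> PS" "pseudo_Steiner \<theta> PS'"
      show "PS = PS'"
        by (rule pseudo_Steiner_eqI[OF mem PS], rule Steiner_map_unique[OF W])
          (rule Steiner_map_of_pseudo_Steiner[OF mem PS(1)]
            Steiner_map_of_pseudo_Steiner[OF mem PS(2)])+
    qed
  qed
qed

end
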